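(* Let $G$ be a decorated tree and let $0\le p<1$. Then there is a constant $c=c_p>0$ such that for all vertices $x,y\in V(G)$, $$\mathbb{P}_p(x\longleftrightarrow y)\le e^{-c\,\operatorname{dist}(x,y)},$$ where $\{x\longleftrightarrow y\}$ is the event that $x$ and $y$ are joined by an open path, and $\operatorname{dist}$ is the graph distance in $G$.
   Context: Percolation. For a locally finite infinite graph $G=(V,E)$ and $0\le p\le 1$, percolation on $G$ with parameter $p$ is the random subset of $E(G)$ (the open edges) in which each edge is open independently with probability $p$; its law is $\mathbb{P}_p$. A path is open if all its edges are open. Decorated trees. Let $T$ be a $(d+1)$-regular tree, $d\ge 2$. An end of $T$ is an equivalence class of rays (half-infinite simple paths), two rays being equivalent if they differ in only finitely many edges. Fix an end $\xi$ of $T$. Let $K=\{\alpha\in\operatorname{Aut}T:\alpha\xi=\xi\}$, and let $L$ be a subgroup of $K$ (possibly $K$ itself) that acts transitively on the vertices of $T$. A decorated tree (or $L$-decorated tree) is any locally finite graph $G=(V(T),E(T)\cup E')$, where $E'$ is a set of unordered pairs of distinct vertices of $T$ with $L\cdot E'=E'$. *)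

theory Defs
  imports "HOL-Probability.Probability" "HOL-Algebra.Bij"
begin

section \<open>Simple graphs\<close>

text \<open>A graph is given by its vertex set \<open>V\<close> and its set \<open>E\<close> of edges, which are unordered
  pairs \<open>{u, v}\<close> of distinct vertices. Paths are simple and include the one-vertex paths.\<close>

definition simple_graph :: "'a set \<Rightarrow> 'a set set \<Rightarrow> bool" where
  "simple_graph V E \<longleftrightarrow> (\<forall>e\<in>E. \<exists>u\<in>V. \<exists>v\<in>V. u \<noteq> v \<and> e = {u, v})"

definition incident_edges :: "'a set set \<Rightarrow> 'a \<Rightarrow> 'a set set" where
  "incident_edges E v = {e \<in> E. v \<in> e}"

definition locally_finite_graph :: "'a set \<Rightarrow> 'a set set \<Rightarrow> bool" where
  "locally_finite_graph V E \<longleftrightarrow> (\<forall>v\<in>V. finite (incident_edges E v))"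

definition regular_graph :: "nat \<Rightarrow> 'a set \<Rightarrow> 'a set set \<Rightarrow> bool" where
  "regular_graph k V E \<longleftrightarrow> (\<forall>v\<in>V. finite (incident_edges E v) \<and> card (incident_edges E v) = k)"

definition graph_path :: "'a set \<Rightarrow> 'a set set \<Rightarrow> 'a list \<Rightarrow> bool" where
  "graph_path V E xs \<longleftrightarrow>
     xs \<noteq> [] \<and> set xs \<subseteq> V \<and> distinct xs \<and> successively (\<lambda>u v. {u, v} \<in> E) xs"

definition path_between :: "'a set \<Rightarrow> 'a set set \<Rightarrow> 'a \<Rightarrow> 'a \<Rightarrow> 'a list \<Rightarrow> bool" where
  "path_between V E x y xs \<longleftrightarrow> graph_path V E xs \<and> hd xs = x \<and> last xs = y"

definition joined :: "'a set \<Rightarrow> 'a set set \<Rightarrow> 'a \<Rightarrow> 'a \<Rightarrow> bool" where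
  "joined V E x y \<longleftrightarrow> (\<exists>xs. path_between V E x y xs)"

definition connected_graph :: "'a set \<Rightarrow> 'a set set \<Rightarrow> bool" where
  "connected_graph V E \<longleftrightarrow> V \<noteq> {} \<and> (\<forall>x\<in>V. \<forall>y\<in>V. joined V E x y)"

definition graph_cycle :: "'a set \<Rightarrow> 'a set set \<Rightarrow> 'a list \<Rightarrow> bool" where
  "graph_cycle V E xs \<longleftrightarrow> graph_path V E xs \<and> 3 \<le> length xs \<and> {last xs, hd xs} \<in> E"

definition tree_graph :: "'a set \<Rightarrow> 'a set set \<Rightarrow> bool" where
  "tree_graph V E \<longleftrightarrow>
     simple_graph V E \<and> connected_graph V E \<and> (\<nexists>xs. graph_cycle V E xs)"

text \<open>A path on \<open>Suc n\<close> vertices has \<open>n\<close> edges. The value is unspecified if \<open>x\<close> and \<open>y\<close>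
  are not joined.\<close>

definition graph_dist :: "'a set \<Rightarrow> 'a set set \<Rightarrow> 'a \<Rightarrow> 'a \<Rightarrow> nat" where
  "graph_dist V E x y = (LEAST n. \<exists>xs. path_between V E x y xs \<and> length xs = Suc n)"


section \<open>Ends and automorphisms\<close>

definition rays :: "'a set \<Rightarrow> 'a set set \<Rightarrow> (nat \<Rightarrow> 'a) set" where
  "rays V E = {r. inj r \<and> range r \<subseteq> V \<and> (\<forall>n. {r n, r (Suc n)} \<in> E)}"

definition ray_edges :: "(nat \<Rightarrow> 'a) \<Rightarrow> 'a set set" where
  "ray_edges r = range (\<lambda>n. {r n, r (Suc n)})"

definition ray_equiv :: "'a set \<Rightarrow> 'a set set \<Rightarrow> ((nat \<Rightarrow> 'a) \<times> (nat \<Rightarrow> 'a)) set" where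
  "ray_equiv V E = {(r, s). r \<in> rays V E \<and> s \<in> rays V E \<and>
     finite ((ray_edges r - ray_edges s) \<union> (ray_edges s - ray_edges r))}"

lemma equiv_ray_equiv: "equiv (rays V E) (ray_equiv V E)"
proof (rule equivI)
  show "trans (ray_equiv V E)"
  proof (rule transI)
    fix r s t assume "(r, s) \<in> ray_equiv V E" "(s, t) \<in> ray_equiv V E"
    moreover have "(ray_edges r - ray_edges t) \<union> (ray_edges t - ray_edges r) \<subseteq>
      ((ray_edges r - ray_edges s) \<union> (ray_edges s - ray_edges r)) \<union>
      ((ray_edges s - ray_edges t) \<union> (ray_edges t - ray_edges s))" by blast
    ultimately show "(r, t) \<in> ray_equiv V E"
      unfolding ray_equiv_def by (auto intro: finite_subset)
  qed
qed (auto simp: ray_equiv_def refl_on_def sym_def Un_commute)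

definition graph_ends :: "'a set \<Rightarrow> 'a set set \<Rightarrow> (nat \<Rightarrow> 'a) set set" where
  "graph_ends V E = rays V E // ray_equiv V E"

definition graph_auts :: "'a set \<Rightarrow> 'a set set \<Rightarrow> ('a \<Rightarrow> 'a) set" where
  "graph_auts V E = {\<alpha> \<in> Bij V. \<forall>u\<in>V. \<forall>v\<in>V. {\<alpha> u, \<alpha> v} \<in> E \<longleftrightarrow> {u, v} \<in> E}"

definition end_image :: "('a \<Rightarrow> 'a) \<Rightarrow> (nat \<Rightarrow> 'a) set \<Rightarrow> (nat \<Rightarrow> 'a) set" where
  "end_image \<alpha> \<xi> = (\<lambda>r. \<alpha> \<circ> r) ` \<xi>"

definition end_stabilizer :: "'a set \<Rightarrow> 'a set set \<Rightarrow> (nat \<Rightarrow> 'a) set \<Rightarrow> ('a \<Rightarrow> 'a) set" where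
  "end_stabilizer V E \<xi> = {\<alpha> \<in> graph_auts V E. end_image \<alpha> \<xi> = \<xi>}"


section \<open>Decorated trees\<close>

text \<open>The decorated tree is the graph \<open>(V, E \<union> E')\<close>; the remaining parameters are
  the data from which it is built.\<close>

locale decorated_tree =
  fixes d :: nat
    and V :: "'a set"
    and E :: "'a set set"
    and \<xi> :: "(nat \<Rightarrow> 'a) set"
    and L :: "('a \<Rightarrow> 'a) set"
    and E' :: "'a set set"
  assumes d_ge_2: "2 \<le> d"
    and tree: "tree_graph V E"
    and regular: "regular_graph (d + 1) V E"
    and end_xi: "\<xi> \<in> graph_ends V E"
    and subgroup_L: "subgroup L (BijGroup V)"
    and L_fixes_end: "L \<subseteq> end_stabilizer V E \<xi>"
    and transitive_L: "\<forall>x\<in>V. \<forall>y\<in>V. \<exists>\<alpha>\<in>L. \<alpha> x = y"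
    and simple_E': "simple_graph V E'"
    and invariant_E': "{\<alpha> ` e |\<alpha> e. \<alpha> \<in> L \<and> e \<in> E'} = E'"
    and locally_finite: "locally_finite_graph V (E \<union> E')"


section \<open>Bernoulli bond percolation\<close>

text \<open>A configuration is the indicator function of the random set of open edges.\<close>

definition percolation :: "'a set set \<Rightarrow> real \<Rightarrow> ('a set \<Rightarrow> bool) measure" where
  "percolation F p = (\<Pi>\<^sub>M e\<in>F. measure_pmf (bernoulli_pmf p))"

definition open_edges :: "'a set set \<Rightarrow> ('a set \<Rightarrow> bool) \<Rightarrow> 'a set set" where
  "open_edges F \<omega> = {e \<in> F. \<omega> e}"

definition connection_event ::
    "'a set \<Rightarrow> 'a set set \<Rightarrow> real \<Rightarrow> 'a \<Rightarrow> 'a \<Rightarrow> ('a set \<Rightarrow> bool) set" where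
  "connection_event V F p x y =
     {\<omega> \<in> space (percolation F p). joined V (open_edges F \<omega>) x y}"

lemma connection_event_sets:
  assumes "countable V"
  shows "connection_event V F p x y \<in> sets (percolation F p)"
proof -
  let ?M = "percolation F p"
  let ?edges = "\<lambda>xs. (\<lambda>i. {xs ! i, xs ! Suc i}) ` {i. Suc i < length xs}"
  let ?P = "{xs \<in> lists V. path_between V F x y xs}"
  have coord: "(\<lambda>\<omega>. \<omega> e) \<in> measurable ?M (count_space UNIV)" if "e \<in> F" for e
  proof -
    have "(\<lambda>\<omega>. \<omega> e) \<in> measurable ?M (measure_pmf (bernoulli_pmf p))"
      unfolding percolation_def using that by (rule measurable_component_singleton)
    also have "\<dots> = measurable ?M (count_space UNIV)"
      by (rule measurable_cong_sets) simp_all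
    finally show ?thesis .
  qed
  have path: "{\<omega> \<in> space ?M. \<forall>e\<in>?edges xs. \<omega> e} \<in> sets ?M" if "path_between V F x y xs" for xs
  proof (rule sets.sets_Collect_finite_All)
    show "finite (?edges xs)" by (rule finite_imageI) (rule finite_subset[of _ "{..<length xs}"], auto)
  next
    fix e assume "e \<in> ?edges xs"
    then have "e \<in> F"
      using that by (auto simp: path_between_def graph_path_def successively_conv_nth)
    then show "{\<omega> \<in> space ?M. \<omega> e} \<in> sets ?M"
      using coord by (simp only: pred_def)
  qed
  have "path_between V (open_edges F \<omega>) x y xs \<longleftrightarrow>
      xs \<in> ?P \<and> (\<forall>e\<in>?edges xs. \<omega> e)" for \<omega> xs
    by (simp add: path_between_def graph_path_def successively_conv_nth open_edges_def lists_eq_set) blast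
  then have "connection_event V F p x y =
      (\<Union>xs\<in>?P. {\<omega> \<in> space ?M. \<forall>e\<in>?edges xs. \<omega> e})"
    unfolding connection_event_def joined_def by blast
  moreover have "countable ?P"
    by (rule countable_subset[OF _ countable_lists[OF assms]]) auto
  ultimately show ?thesis
    using path by (simp only:) (rule sets.countable_UN'', assumption, blast)
qed

lemma countable_vertices:
  assumes "simple_graph V E" "connected_graph V E" "locally_finite_graph V E"
  shows "countable V"
proof -
  obtain o' where o': "o' \<in> V" using assms(2) unfolding connected_graph_def by blast
  define N where "N = (\<lambda>A. A \<union> (\<Union>v\<in>A. \<Union>(incident_edges E v)))"
  have fin_edge: "finite e" "e \<subseteq> V" if "e \<in> E" for e
    using that assms(1) by (auto simp: simple_graph_def)
  have fin: "finite ((N ^^ n) {o'}) \<and> (N ^^ n) {o'} \<subseteq> V" for n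
  proof (induction n)
    case (Suc n)
    let ?A = "(N ^^ n) {o'}"
    have "finite (\<Union>v\<in>?A. \<Union>(incident_edges E v))"
    proof (intro finite_UN_I finite_Union)
      fix v e
      assume v: "v \<in> ?A"
      then show "finite (incident_edges E v)"
        using Suc assms(3) by (auto simp: locally_finite_graph_def)
      show "finite e" if "e \<in> incident_edges E v"
        using that fin_edge by (simp add: incident_edges_def)
    qed (use Suc in simp)
    moreover have "(\<Union>v\<in>?A. \<Union>(incident_edges E v)) \<subseteq> V"
      using fin_edge(2) by (auto simp: incident_edges_def)
    ultimately show ?case
      using Suc by (simp add: N_def)
  qed (simp add: o')
  have reach: "xs ! i \<in> (N ^^ i) {o'}"
    if "graph_path V E xs" "hd xs = o'" "i < length xs" for xs i
    using that(3)
  proof (induction i)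
    case 0
    then show ?case using that by (simp add: hd_conv_nth)
  next
    case (Suc i)
    then have "{xs ! i, xs ! Suc i} \<in> E" "xs ! i \<in> (N ^^ i) {o'}"
      using that by (auto simp: graph_path_def successively_conv_nth)
    then show ?case by (auto simp: N_def incident_edges_def)
  qed
  have "V \<subseteq> (\<Union>n. (N ^^ n) {o'})"
  proof
    fix y assume "y \<in> V"
    then obtain xs where xs: "graph_path V E xs" "hd xs = o'" "last xs = y"
      using assms(2) o' unfolding connected_graph_def joined_def path_between_def by blast
    then have "xs \<noteq> []" by (simp add: graph_path_def)
    with reach[OF xs(1,2), of "length xs - 1"] xs(3)
    show "y \<in> (\<Union>n. (N ^^ n) {o'})" by (auto simp: last_conv_nth)
  qed
  moreover have "countable (\<Union>n. (N ^^ n) {o'})"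
    using fin by (auto intro: countable_finite)
  ultimately show ?thesis by (rule countable_subset)
qed

lemma (in decorated_tree) connection_event_measurable:
  "connection_event V (E \<union> E') p x y \<in> sets (percolation (E \<union> E') p)"
proof -
  have "locally_finite_graph V E"
    using regular by (auto simp: regular_graph_def locally_finite_graph_def)
  then have "countable V"
    using countable_vertices tree by (auto simp: tree_graph_def)
  then show ?thesis by (rule connection_event_sets)
qed

end

theory Submission
  imports Defs
begin

text \<open>
  The decorated tree looks like the tree \<open>T = (V, E)\<close> from afar, and a tree has small cuts everywhere
  along each of its geodesics.

  Since \<open>L\<close> is transitive and preserves both the decoration and the tree metric, local finiteness at
  a single vertex gives a number \<open>R\<close> such that the ends of every edge of the decorated tree are at
  tree distance at most \<open>R\<close> (\<open>bounded_range\<close>). Let \<open>f 0, \<dots>, f n\<close> be the geodesic in \<open>T\<close> from \<open>x\<close>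
  to \<open>y\<close>. Deleting its edge \<open>{f i, f (Suc i)}\<close> splits \<open>T\<close> into two sides, one containing \<open>x\<close> and the
  other \<open>y\<close>. The tree geodesic between the ends of an edge that joins the two sides has to pass
  through the deleted edge, so both ends of the edge lie within tree distance \<open>R\<close> of \<open>f i\<close>
  (\<open>tree_cut\<close>). By transitivity, each such cut has at most \<open>N\<close> edges, with \<open>N\<close> independent of \<open>i\<close>,
  \<open>x\<close> and \<open>y\<close> (\<open>bounded_edges_near\<close>).

  Cuts at positions that differ by at least \<open>M = 2 * R + 1\<close> are disjoint. Every open path from \<open>x\<close> to
  \<open>y\<close> has an edge in each cut, and an individual cut contains an open edge with probability at most
  \<open>1 - (1 - p) ^ N < 1\<close>. As disjoint sets of edges are independent, the connection probability is at
  most \<open>(1 - (1 - p) ^ N) ^ m\<close>, where \<open>m \<ge> n / M\<close> is the number of cuts used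
  (\<open>prob_open_in_disjoint_sets\<close>). Finally, \<open>n\<close> is at least the distance in the decorated tree, as the
  latter contains \<open>T\<close>.
\<close>

section \<open>Walks and the tree metric\<close>

text \<open>The adjacency relation of an edge set. Walks of length \<open>k\<close> are expressed by its relational power
  \<open>adj F ^^ k\<close>, which is more convenient to concatenate than simple paths.\<close>

definition adj :: "'a set set \<Rightarrow> ('a \<times> 'a) set" where
  "adj F = {(u, v). {u, v} \<in> F}"

text \<open>The vertices \<open>u\<close> and \<open>v\<close> are at distance at most \<open>n\<close> in the graph with edge set \<open>F\<close>. Unlike
  \<open>graph_dist\<close>, the relation is false for pairs that are not connected.\<close>

definition close_by :: "'a set set \<Rightarrow> nat \<Rightarrow> 'a \<Rightarrow> 'a \<Rightarrow> bool" where
  "close_by F n u v \<longleftrightarrow> (\<exists>k\<le>n. (u, v) \<in> adj F ^^ k)"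

lemma sym_adj: "sym (adj F)"
  by (auto simp: adj_def sym_def insert_commute)

lemma relpow_map:
  assumes "(u, v) \<in> r ^^ k" and "\<And>a b. (a, b) \<in> r \<Longrightarrow> (h a, h b) \<in> s"
  shows "(h u, h v) \<in> s ^^ k"
  using assms(1)
proof (induction k arbitrary: v)
  case (Suc k)
  then obtain w where "(u, w) \<in> r ^^ k" "(w, v) \<in> r" by (auto elim: relpow_Suc_E)
  then show ?case by (intro relpow_Suc_I[OF Suc.IH assms(2)])
qed simp

lemma relpow_adj_sym:
  assumes "(u, v) \<in> adj F ^^ k"
  shows "(v, u) \<in> adj F ^^ k"
  using assms
proof (induction k arbitrary: v)
  case (Suc k)
  then obtain w where "(u, w) \<in> adj F ^^ k" "(w, v) \<in> adj F" by (auto elim: relpow_Suc_E)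
  with Suc.IH[of w] show ?case by (intro relpow_Suc_I2[OF symD[OF sym_adj]])
qed simp

lemma close_by_sym: "close_by F n u v \<Longrightarrow> close_by F n v u"
  unfolding close_by_def using relpow_adj_sym by metis

lemma relpow_segment:
  assumes "\<forall>i<n. (f i, f (Suc i)) \<in> r" and "i \<le> j" and "j \<le> n"
  shows "(f i, f j) \<in> r ^^ (j - i)"
proof -
  have "\<forall>k<j - i. (f (i + k), f (i + Suc k)) \<in> r" using assms by simp
  then show ?thesis
    using assms(2) by (auto simp: relpow_fun_conv intro!: exI[of _ "\<lambda>k. f (i + k)"])
qed

text \<open>A shortest walk is geodesic: its \<open>i\<close>-th and \<open>j\<close>-th points are at distance at least \<open>\<bar>j - i\<bar>\<close>. Otherwise a
  shortcut between them would shorten the walk.\<close>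

lemma shortest_walk_relpow:
  assumes walk: "\<forall>i<n. (f i, f (Suc i)) \<in> r"
    and shortest: "\<And>m. (f 0, f n) \<in> r ^^ m \<Longrightarrow> n \<le> m"
    and "i \<le> j" "j \<le> n" and "(f i, f j) \<in> r ^^ k"
  shows "j - i \<le> k"
proof -
  have "(f 0, f i) \<in> r ^^ i" "(f j, f n) \<in> r ^^ (n - j)"
    using relpow_segment[OF walk, of 0 i] relpow_segment[OF walk, of j n] assms(3,4) by auto
  then have "(f 0, f n) \<in> r ^^ (i + k + (n - j))"
    using assms(5) by (blast intro: relpow_trans)
  then show ?thesis using shortest assms(3,4) by fastforce
qed

lemma shortest_walk_inj:
  assumes "\<forall>i<n. (f i, f (Suc i)) \<in> r"
    and "\<And>m. (f 0, f n) \<in> r ^^ m \<Longrightarrow> n \<le> m"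
  shows "inj_on f {..n}"
proof (rule linorder_inj_onI)
  fix i j assume "i < j" "i \<in> {..n}" "j \<in> {..n}"
  then show "f i \<noteq> f j"
    using shortest_walk_relpow[OF assms, of i j 0] by auto
qed auto

lemma obtain_shortest_walk:
  assumes "(x, y) \<in> r ^^ k"
  obtains n f where "n \<le> k" "f 0 = x" "f n = y" "\<forall>i<n. (f i, f (Suc i)) \<in> r"
    "\<forall>m. (x, y) \<in> r ^^ m \<longrightarrow> n \<le> m"
proof -
  define n where "n = (LEAST n. (x, y) \<in> r ^^ n)"
  have "(x, y) \<in> r ^^ n" unfolding n_def using assms by (rule LeastI)
  then obtain f where "f 0 = x" "f n = y" "\<forall>i<n. (f i, f (Suc i)) \<in> r"
    by (auto simp: relpow_fun_conv)
  moreover have "\<forall>m. (x, y) \<in> r ^^ m \<longrightarrow> n \<le> m" unfolding n_def by (auto intro: Least_le)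
  ultimately show ?thesis using that assms by blast
qed

text \<open>A shortest walk is injective, hence a simple path; so every walk can be replaced by a path that
  is not longer.\<close>

lemma path_between_of_relpow:
  assumes "(x, y) \<in> adj F ^^ k" and "x \<in> V" and "\<Union>F \<subseteq> V"
  obtains xs where "path_between V F x y xs" "length xs \<le> Suc k"
proof -
  from assms(1) obtain n f where f: "n \<le> k" "f 0 = x" "f n = y"
    "\<forall>i<n. (f i, f (Suc i)) \<in> adj F" "\<forall>m. (x, y) \<in> adj F ^^ m \<longrightarrow> n \<le> m"
    by (rule obtain_shortest_walk)
  have inj: "inj_on f {..n}" by (rule shortest_walk_inj[of _ _ "adj F"]) (use f in auto)
  have V: "f i \<in> V" if "i \<le> n" for i
  proof (cases i)
    case (Suc j)
    then have "{f j, f (Suc j)} \<in> F" using f(4) that by (auto simp: adj_def)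
    then show ?thesis using assms(3) Suc by auto
  qed (use f(2) assms(2) in simp)
  let ?xs = "map f [0..<Suc n]"
  have "distinct ?xs"
    unfolding distinct_map using inj by (auto intro: inj_on_subset simp del: upt_Suc)
  moreover have "successively (\<lambda>u v. {u, v} \<in> F) ?xs"
    unfolding successively_conv_nth using f(4) by (auto simp: adj_def simp del: upt_Suc)
  moreover have "hd ?xs = x" "last ?xs = y"
    using f(2,3) by (simp_all add: hd_map hd_upt del: upt_Suc) (simp add: last_map)
  ultimately have "path_between V F x y ?xs"
    using V unfolding path_between_def graph_path_def by (auto simp del: upt_Suc)
  then show ?thesis using that f(1) by simp
qed

lemma relpow_of_path_between:
  assumes "path_between V F x y xs"
  shows "(x, y) \<in> adj F ^^ (length xs - 1)"
proof -
  have "hd xs = xs ! 0" "last xs = xs ! (length xs - 1)"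
    using assms by (auto simp: path_between_def graph_path_def hd_conv_nth last_conv_nth)
  then show ?thesis
    using assms unfolding relpow_fun_conv path_between_def graph_path_def successively_conv_nth
    by (intro exI[of _ "nth xs"]) (auto simp: adj_def)
qed

lemma graph_dist_le_relpow:
  assumes "(x, y) \<in> adj F ^^ k" and "x \<in> V" and "\<Union>F \<subseteq> V"
  shows "graph_dist V F x y \<le> k"
proof -
  obtain xs where xs: "path_between V F x y xs" "length xs \<le> Suc k"
    using path_between_of_relpow[OF assms] .
  then have "length xs = Suc (length xs - 1)"
    by (cases xs) (auto simp: path_between_def graph_path_def)
  with xs(1) have "graph_dist V F x y \<le> length xs - 1"
    unfolding graph_dist_def by (intro Least_le) blast
  with xs(2) show ?thesis by simp
qed


section \<open>Edge cuts\<close>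

text \<open>The edge boundary of a vertex set \<open>S\<close>: the edges with exactly one end in \<open>S\<close>.\<close>

definition edge_cut :: "'a set set \<Rightarrow> 'a set \<Rightarrow> 'a set set" where
  "edge_cut F S = {e \<in> F. \<exists>a b. e = {a, b} \<and> a \<in> S \<and> b \<notin> S}"

text \<open>The walk is split at a step that leaves \<open>S\<close>; the lengths of the two remaining pieces are recorded,
  since they bound the distance from the ends of the walk to that step.\<close>

lemma walk_leaves_set:
  assumes "(x, y) \<in> r ^^ k" and "x \<in> S" and "y \<notin> S"
  obtains i a b where "i < k" "(x, a) \<in> r ^^ i" "(a, b) \<in> r" "(b, y) \<in> r ^^ (k - Suc i)"
    "a \<in> S" "b \<notin> S"
proof -
  obtain f where f: "f 0 = x" "f k = y" "\<forall>i<k. (f i, f (Suc i)) \<in> r"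
    using assms(1) by (auto simp: relpow_fun_conv)
  have "\<exists>i<k. f i \<in> S \<and> f (Suc i) \<notin> S"
  proof (rule ccontr)
    assume "\<not> ?thesis"
    then have "i \<le> k \<Longrightarrow> f i \<in> S" for i
      using f(1) assms(2) by (induction i) auto
    then show False using f(2) assms(3) by auto
  qed
  then obtain i where i: "i < k" "f i \<in> S" "f (Suc i) \<notin> S" by blast
  show ?thesis
    using that[OF i(1) _ _ _ i(2,3)] relpow_segment[OF f(3), of 0 i] relpow_segment[OF f(3), of "Suc i" k]
      f i(1) by auto
qed

lemma joined_meets_edge_cut:
  assumes "joined V (open_edges F \<omega>) x y" and "x \<in> S" and "y \<notin> S"
  shows "\<exists>e\<in>edge_cut F S. \<omega> e"
proof -
  obtain k where "(x, y) \<in> adj (open_edges F \<omega>) ^^ k"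
    using assms(1) relpow_of_path_between unfolding joined_def by metis
  from this assms(2,3) obtain a b where "(a, b) \<in> adj (open_edges F \<omega>)" "a \<in> S" "b \<notin> S"
    by (rule walk_leaves_set)
  then show ?thesis by (auto simp: adj_def open_edges_def edge_cut_def)
qed

text \<open>Deleting an edge of a tree separates its two ends, since a path between them in the rest
  of the tree would close up to a cycle.\<close>

lemma tree_edge_separates:
  assumes tree: "tree_graph V E" and "{u, v} \<in> E"
  shows "(u, v) \<notin> adj (E - {{u, v}}) ^^ k"
proof
  assume k: "(u, v) \<in> adj (E - {{u, v}}) ^^ k"
  let ?E = "E - {{u, v}}"
  have simple: "\<forall>e\<in>E. \<exists>u\<in>V. \<exists>v\<in>V. u \<noteq> v \<and> e = {u, v}"
    using tree by (simp add: tree_graph_def simple_graph_def)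
  have uv: "u \<noteq> v" "u \<in> V" using simple assms(2) by (metis doubleton_eq_iff)+
  have EV: "\<Union>?E \<subseteq> V" using simple by fastforce
  obtain xs where xs: "path_between V ?E u v xs"
    using path_between_of_relpow[OF k uv(2) EV] by blast
  then have path: "graph_path V ?E xs" "hd xs = u" "last xs = v"
    by (auto simp: path_between_def)
  have "3 \<le> length xs"
  proof (rule ccontr)
    assume "\<not> 3 \<le> length xs"
    then have "length xs = 0 \<or> length xs = 1 \<or> length xs = 2" by linarith
    then show False
      using path uv(1) by (auto simp: graph_path_def length_Suc_conv numeral_2_eq_2)
  qed
  moreover have "graph_path V E xs"
    using path(1) by (auto simp: graph_path_def successively_conv_nth)
  ultimately have "graph_cycle V E xs"
    using path(2,3) assms(2) by (auto simp: graph_cycle_def insert_commute)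
  then show False using tree by (auto simp: tree_graph_def)
qed

text \<open>Removing the edge \<open>{f i, f (Suc i)}\<close> of a geodesic from the tree leaves a side \<open>S\<close> that
  contains the start of the geodesic but not its end. A tree walk from \<open>S\<close> to its complement must
  use the removed edge, so edges of bounded range can only cross near \<open>f i\<close>.\<close>

lemma tree_cut:
  assumes tree: "tree_graph V E"
    and walk: "\<forall>i<n. (f i, f (Suc i)) \<in> adj E"
    and shortest: "\<And>m. (f 0, f n) \<in> adj E ^^ m \<Longrightarrow> n \<le> m"
    and i: "i < n"
    and range: "\<And>a b. {a, b} \<in> F \<Longrightarrow> close_by E R a b"
  obtains S where "f 0 \<in> S" "f n \<notin> S" "\<And>e a. e \<in> edge_cut F S \<Longrightarrow> a \<in> e \<Longrightarrow> close_by E R a (f i)"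
proof -
  let ?e = "{f i, f (Suc i)}"
  let ?r = "adj (E - {?e})"
  define S where "S = {z. (f 0, z) \<in> ?r\<^sup>*}"
  have inj: "inj_on f {..n}" by (rule shortest_walk_inj[OF walk shortest])
  have edge: "(f j, f (Suc j)) \<in> ?r" if "j < n" "j \<noteq> i" for j
    using that walk i inj_onD[OF inj, of j i] inj_onD[OF inj, of "Suc j" "Suc i"]
      inj_onD[OF inj, of j "Suc i"] inj_onD[OF inj, of "Suc j" i]
    by (auto simp: adj_def doubleton_eq_iff)
  have "\<forall>j<i. (f j, f (Suc j)) \<in> ?r" using edge i by simp
  from relpow_segment[OF this, of 0 i] have f0: "(f 0, f i) \<in> ?r\<^sup>*"
    by (auto intro: relpow_imp_rtrancl)
  have "\<forall>j<n - Suc i. (f (Suc i + j), f (Suc i + Suc j)) \<in> ?r" using edge i by simp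
  from relpow_segment[OF this, of 0 "n - Suc i"] i have fn: "(f (Suc i), f n) \<in> ?r\<^sup>*"
    by (auto intro: relpow_imp_rtrancl)
  have sym: "(b, a) \<in> ?r\<^sup>*" if "(a, b) \<in> ?r\<^sup>*" for a b
    using that sym_rtrancl[OF sym_adj] by (metis symD)
  have "f n \<notin> S"
  proof
    assume "f n \<in> S"
    then have "(f i, f (Suc i)) \<in> ?r\<^sup>*"
      using f0 fn sym unfolding S_def by (metis mem_Collect_eq rtrancl_trans)
    then obtain k where "(f i, f (Suc i)) \<in> ?r ^^ k" by (auto simp: rtrancl_is_UN_relpow)
    then show False
      using tree_edge_separates[OF tree, of "f i" "f (Suc i)" k] walk i by (auto simp: adj_def)
  qed
  moreover have "f 0 \<in> S" by (simp add: S_def)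
  moreover have "close_by E R a (f i)" if e: "e \<in> edge_cut F S" "a \<in> e" for e a
  proof -
    from e(1) obtain u v where uv: "e = {u, v}" "{u, v} \<in> F" "u \<in> S" "v \<notin> S"
      by (auto simp: edge_cut_def)
    then obtain k where k: "k \<le> R" "(u, v) \<in> adj E ^^ k" using range by (auto simp: close_by_def)
    from k(2) uv(3,4) obtain j b c where j: "j < k" "(u, b) \<in> adj E ^^ j" "(b, c) \<in> adj E"
      "(c, v) \<in> adj E ^^ (k - Suc j)" "b \<in> S" "c \<notin> S" by (rule walk_leaves_set)
    have "(b, c) \<notin> ?r" using j(5,6) by (auto simp: S_def dest: rtrancl_into_rtrancl)
    then have "{b, c} = ?e" using j(3) by (auto simp: adj_def)
    then have "f i = b \<or> f i = c" by (auto simp: doubleton_eq_iff)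
    \<comment> \<open>Hence the walk from \<open>u\<close> to \<open>v\<close> visits \<open>f i\<close>, which bounds the distance from both ends.\<close>
    then have "\<exists>l\<le>k. (u, f i) \<in> adj E ^^ l \<and> (f i, v) \<in> adj E ^^ (k - l)"
    proof
      assume "f i = b"
      moreover have "(b, v) \<in> adj E ^^ (k - j)"
        using relpow_Suc_I2[OF j(3,4)] j(1) by (simp add: Suc_diff_Suc)
      ultimately show ?thesis using j(1,2) by (intro exI[of _ j]) auto
    next
      assume "f i = c"
      then show ?thesis using relpow_Suc_I[OF j(2,3)] j(1,4) by (intro exI[of _ "Suc j"]) auto
    qed
    then obtain l where l: "l \<le> k" "(u, f i) \<in> adj E ^^ l" "(f i, v) \<in> adj E ^^ (k - l)" by blast
    then have "close_by E R u (f i)" "close_by E R (f i) v"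
      using k(1) unfolding close_by_def by (meson le_trans, meson diff_le_self le_trans)
    then show ?thesis using uv(1) e(2) close_by_sym by auto
  qed
  ultimately show ?thesis using that by blast
qed


section \<open>Uniformity from the transitive group action\<close>

context decorated_tree
begin

lemma edge_ends_in_V: "{u, v} \<in> E \<union> E' \<Longrightarrow> u \<in> V \<and> v \<in> V"
  using tree simple_E' unfolding tree_graph_def simple_graph_def
  by (metis UnE doubleton_eq_iff)

lemma edges_subset: "\<Union>(E \<union> E') \<subseteq> V"
  using tree simple_E' unfolding tree_graph_def simple_graph_def by fastforce

lemma L_bij: "\<alpha> \<in> L \<Longrightarrow> bij_betw \<alpha> V V"
  using subgroup.subset[OF subgroup_L] by (auto simp: BijGroup_def Bij_def)

lemma L_edge: "\<alpha> \<in> L \<Longrightarrow> u \<in> V \<Longrightarrow> v \<in> V \<Longrightarrow> {\<alpha> u, \<alpha> v} \<in> E \<longleftrightarrow> {u, v} \<in> E"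
  using L_fixes_end by (auto simp: end_stabilizer_def graph_auts_def)

lemma L_edge_image:
  assumes "\<alpha> \<in> L" and "e \<in> E \<union> E'"
  shows "\<alpha> ` e \<in> E \<union> E'"
proof (cases "e \<in> E'")
  case True
  then show ?thesis using assms(1) invariant_E' by blast
next
  case False
  then have "e \<in> E" using assms(2) by simp
  moreover from this obtain u v where "u \<in> V" "v \<in> V" "e = {u, v}"
    using tree by (auto simp: tree_graph_def simple_graph_def)
  ultimately show ?thesis using L_edge[OF assms(1)] by simp
qed

lemma close_by_L_iff:
  assumes "\<alpha> \<in> L" "u \<in> V" "v \<in> V"
  shows "close_by E n (\<alpha> u) (\<alpha> v) \<longleftrightarrow> close_by E n u v"
proof -
  have bij: "bij_betw \<alpha> V V" by (rule L_bij[OF assms(1)])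
  let ?\<beta> = "inv_into V \<alpha>"
  have \<beta>: "?\<beta> (\<alpha> w) = w" "\<alpha> (?\<beta> w) = w" "?\<beta> w \<in> V" if "w \<in> V" for w
    using that bij by (auto simp: bij_betw_inv_into_left bij_betw_inv_into_right
        intro: bij_betw_apply[OF bij_betw_inv_into])
  have "(\<alpha> a, \<alpha> b) \<in> adj E" "(?\<beta> a, ?\<beta> b) \<in> adj E" if "(a, b) \<in> adj E" for a b
    using that edge_ends_in_V[of a b] L_edge[OF assms(1), of a b] L_edge[OF assms(1), of "?\<beta> a" "?\<beta> b"] \<beta>
    by (auto simp: adj_def)
  then have "(\<alpha> u, \<alpha> v) \<in> adj E ^^ k \<longleftrightarrow> (u, v) \<in> adj E ^^ k" for k
    using relpow_map[of u v k "adj E" \<alpha> "adj E"] relpow_map[of "\<alpha> u" "\<alpha> v" k "adj E" ?\<beta> "adj E"] \<beta> assms(2,3) by auto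
  then show ?thesis by (simp add: close_by_def)
qed

lemma finite_neighbours:
  assumes "v \<in> V"
  shows "finite {w. {v, w} \<in> E \<union> E'}"
proof -
  have "finite (incident_edges (E \<union> E') v)"
    using locally_finite assms by (auto simp: locally_finite_graph_def)
  moreover have "finite e" if "e \<in> E \<union> E'" for e
    using that tree simple_E' by (auto simp: tree_graph_def simple_graph_def)
  ultimately have "finite (\<Union>(incident_edges (E \<union> E') v))"
    by (auto simp: incident_edges_def)
  then show ?thesis by (rule rev_finite_subset) (auto simp: incident_edges_def)
qed

lemma finite_tree_ball:
  assumes "v \<in> V"
  shows "finite {w. close_by E n v w} \<and> {w. close_by E n v w} \<subseteq> V"
proof -
  have "finite {w. (v, w) \<in> adj E ^^ k} \<and> {w. (v, w) \<in> adj E ^^ k} \<subseteq> V" for k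
  proof (induction k)
    case (Suc k)
    have "finite {w. {u, w} \<in> E}" if "u \<in> V" for u
      by (rule finite_subset[OF _ finite_neighbours[OF that]]) auto
    then have "finite (\<Union>u\<in>{u. (v, u) \<in> adj E ^^ k}. {w. {u, w} \<in> E})"
      using Suc by blast
    then have "finite {w. (v, w) \<in> adj E ^^ Suc k}"
      by (rule rev_finite_subset) (auto simp: adj_def)
    then show ?case using edge_ends_in_V by (auto simp: adj_def)
  qed (use assms in auto)
  moreover have "{w. close_by E n v w} = (\<Union>k\<le>n. {w. (v, w) \<in> adj E ^^ k})"
    by (auto simp: close_by_def)
  ultimately show ?thesis by auto
qed

lemma tree_connected:
  assumes "x \<in> V" "y \<in> V"
  shows "\<exists>k. (x, y) \<in> adj E ^^ k"
  using assms tree relpow_of_path_between unfolding tree_graph_def connected_graph_def joined_def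
  by meson

text \<open>Up to the group, every edge has a fixed vertex as an end, and that vertex has finitely many
  neighbours; so the edges have bounded range in the tree metric.\<close>

lemma bounded_range:
  obtains R where "\<And>a b. {a, b} \<in> E \<union> E' \<Longrightarrow> close_by E R a b"
proof -
  obtain o' where o': "o' \<in> V" using tree by (auto simp: tree_graph_def connected_graph_def)
  define N where "N = {w. {o', w} \<in> E \<union> E'}"
  have fin: "finite N" unfolding N_def by (rule finite_neighbours[OF o'])
  have "\<forall>w\<in>N. \<exists>k. (o', w) \<in> adj E ^^ k" using edge_ends_in_V tree_connected[OF o'] by (auto simp: N_def)
  then obtain k where k: "\<And>w. w \<in> N \<Longrightarrow> (o', w) \<in> adj E ^^ k w" by metis
  define R where "R = Max (k ` N)"
  have R: "close_by E R o' w" if "w \<in> N" for w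
    using k[OF that] fin that by (auto simp: close_by_def R_def intro!: exI[of _ "k w"])
  have "close_by E R a b" if ab: "{a, b} \<in> E \<union> E'" for a b
  proof -
    have V: "a \<in> V" "b \<in> V" using edge_ends_in_V[OF ab] by auto
    obtain \<alpha> where \<alpha>: "\<alpha> \<in> L" "\<alpha> a = o'" using transitive_L V o' by blast
    have "{o', \<alpha> b} \<in> E \<union> E'" using L_edge_image[OF \<alpha>(1) ab] \<alpha>(2) by simp
    then have "close_by E R (\<alpha> a) (\<alpha> b)" using R \<alpha>(2) by (simp add: N_def)
    then show ?thesis using close_by_L_iff[OF \<alpha>(1) V] by simp
  qed
  then show ?thesis using that by blast
qed

text \<open>An element of \<open>L\<close> that moves \<open>v\<close> to a fixed base vertex embeds a set of edges in the ball around
  \<open>v\<close> into the subsets of the finite ball around the base vertex.\<close>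

lemma bounded_edges_near:
  obtains N where "\<And>v C. v \<in> V \<Longrightarrow> C \<subseteq> E \<union> E' \<Longrightarrow> (\<And>e a. e \<in> C \<Longrightarrow> a \<in> e \<Longrightarrow> close_by E R a v)
    \<Longrightarrow> finite C \<and> card C \<le> N"
proof -
  obtain o' where o': "o' \<in> V" using tree by (auto simp: tree_graph_def connected_graph_def)
  define W where "W = Pow {w. close_by E R o' w}"
  have fin: "finite W" using finite_tree_ball[OF o'] by (simp add: W_def)
  have "finite C \<and> card C \<le> card W"
    if v: "v \<in> V" and C: "C \<subseteq> E \<union> E'" and near: "\<And>e a. e \<in> C \<Longrightarrow> a \<in> e \<Longrightarrow> close_by E R a v" for v C
  proof -
    obtain \<alpha> where \<alpha>: "\<alpha> \<in> L" "\<alpha> v = o'" using transitive_L v o' by blast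
    have CV: "\<Union>C \<subseteq> V" using C edges_subset by blast
    have "(`) \<alpha> ` C \<subseteq> W"
    proof safe
      fix e assume e: "e \<in> C"
      have "close_by E R o' (\<alpha> a)" if "a \<in> e" for a
        using close_by_L_iff[OF \<alpha>(1), of v a R] close_by_sym[OF near[OF e that]] CV e that \<alpha>(2) v
        by auto
      then show "\<alpha> ` e \<in> W" by (auto simp: W_def)
    qed
    moreover have "inj_on ((`) \<alpha>) C"
      using L_bij[OF \<alpha>(1)] CV by (intro inj_on_image) (auto simp: bij_betw_def intro: inj_on_subset)
    ultimately show ?thesis using fin by (meson card_inj_on_le inj_on_finite)
  qed
  then show ?thesis using that by blast
qed

end


section \<open>Disjoint cuts in percolation\<close>

text \<open>The coordinates are independent, and so are their restrictions to disjoint sets of edges.\<close>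

lemma prob_open_in_disjoint_sets:
  fixes F :: "'a set set" and C :: "'i \<Rightarrow> 'a set set"
  assumes p: "0 \<le> p" "p \<le> 1" and I: "finite I"
    and C: "\<And>i. i \<in> I \<Longrightarrow> C i \<subseteq> F" "\<And>i. i \<in> I \<Longrightarrow> finite (C i)" "\<And>i. i \<in> I \<Longrightarrow> card (C i) \<le> N"
    and disj: "disjoint_family_on C I"
  shows "measure (percolation F p) {\<omega> \<in> space (percolation F p). \<forall>i\<in>I. \<exists>e\<in>C i. \<omega> e}
           \<le> (1 - (1 - p) ^ N) ^ card I"
proof -
  let ?B = "\<lambda>_::'a set. measure_pmf (bernoulli_pmf p)"
  let ?M = "percolation F p"
  interpret B: product_prob_space ?B F
    by unfold_locales
  have M: "?M = Pi\<^sub>M F ?B" by (simp add: percolation_def)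
  interpret P: prob_space ?M unfolding M by (rule B.P.prob_space_axioms)
  show ?thesis
  proof (cases "I = {} \<or> F = {}")
    case True
    show ?thesis
    proof (cases "I = {}")
      case False
      with True C(1) have "{\<omega> \<in> space ?M. \<forall>i\<in>I. \<exists>e\<in>C i. \<omega> e} = {}" by blast
      then show ?thesis using p by (simp only: measure_empty) (simp add: power_le_one)
    qed simp
  next
    case False
    have coord: "(\<lambda>\<omega>. \<omega> e) \<in> measurable ?M (?B e)" if "e \<in> F" for e
      unfolding M using that by (rule measurable_component_singleton)
    \<comment> \<open>The joint law of the coordinates is the product of their laws.\<close>
    have indep: "P.indep_vars ?B (\<lambda>e \<omega>. \<omega> e) F"
    proof -
      have "distr ?M (Pi\<^sub>M F ?B) (\<lambda>\<omega>. \<lambda>e\<in>F. \<omega> e) = distr ?M ?M (\<lambda>\<omega>. \<omega>)"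
        by (rule distr_cong) (auto simp: M space_PiM)
      also have "\<dots> = Pi\<^sub>M F (\<lambda>e. distr ?M (?B e) (\<lambda>\<omega>. \<omega> e))"
        unfolding distr_id by (subst M, rule PiM_cong) (auto simp: M B.PiM_component)
      finally show ?thesis
        using False coord by (subst P.indep_vars_iff_distr_eq_PiM') auto
    qed
    have indepC: "P.indep_vars (\<lambda>i. Pi\<^sub>M (C i) ?B) (\<lambda>i \<omega>. restrict (\<lambda>e. \<omega> e) (C i)) I"
      by (rule P.indep_vars_restrict[OF indep C(1) disj])
    let ?A = "\<lambda>i. {\<omega> \<in> space (Pi\<^sub>M (C i) ?B). \<exists>e\<in>C i. \<omega> e}"
    have A: "?A i \<in> sets (Pi\<^sub>M (C i) ?B)" if "i \<in> I" for i
    proof (rule sets.sets_Collect_finite_Ex[OF _ C(2)[OF that]])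
      fix e assume e: "e \<in> C i"
      have "(\<lambda>\<omega>. \<omega> e) \<in> measurable (Pi\<^sub>M (C i) ?B) (?B e)"
        using e by (rule measurable_component_singleton)
      from measurable_sets[OF this, of "{True}"]
      show "{\<omega> \<in> space (Pi\<^sub>M (C i) ?B). \<omega> e} \<in> sets (Pi\<^sub>M (C i) ?B)"
        by (simp add: vimage_def Int_def conj_commute)
    qed
    have restr: "(\<lambda>\<omega>. restrict (\<lambda>e. \<omega> e) (C i)) -` ?A i \<inter> space ?M
        = {\<omega> \<in> space ?M. \<exists>e\<in>C i. \<omega> e}" if "i \<in> I" for i
      by (auto simp: space_PiM M)
    have single: "P.prob {\<omega> \<in> space ?M. \<exists>e\<in>C i. \<omega> e} \<le> 1 - (1 - p) ^ N" if i: "i \<in> I" for i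
    proof -
      let ?Z = "{\<omega> \<in> space ?M. \<forall>e\<in>C i. \<omega> e \<in> {False}}"
      have emb: "?Z = prod_emb F ?B (C i) (Pi\<^sub>E (C i) (\<lambda>_. {False}))"
        unfolding M prod_emb_def space_PiM vimage_def Int_def mem_Collect_eq restrict_PiE_iff
        by (simp only: conj_commute)
      have "P.prob ?Z = (\<Prod>e\<in>C i. measure (?B e) {False})"
        unfolding emb unfolding M by (rule B.measure_PiM_emb[OF C(1,2)[OF i]]) simp
      also have "\<dots> = (1 - p) ^ card (C i)"
        using p by (simp add: measure_pmf_single)
      finally have Z: "P.prob ?Z = (1 - p) ^ card (C i)" .
      have Z_events: "?Z \<in> P.events"
        unfolding emb unfolding M by (rule sets_PiM_I[OF C(2)[OF i] C(1)[OF i]]) simp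
      have "{\<omega> \<in> space ?M. \<exists>e\<in>C i. \<omega> e} = space ?M - ?Z" by auto
      then have "P.prob {\<omega> \<in> space ?M. \<exists>e\<in>C i. \<omega> e} = 1 - (1 - p) ^ card (C i)"
        using P.prob_compl[OF Z_events] Z by simp
      also have "\<dots> \<le> 1 - (1 - p) ^ N"
        using power_decreasing[OF C(3)[OF i], of "1 - p"] p by simp
      finally show ?thesis .
    qed
    have "{\<omega> \<in> space ?M. \<forall>i\<in>I. \<exists>e\<in>C i. \<omega> e} = (\<Inter>i\<in>I. {\<omega> \<in> space ?M. \<exists>e\<in>C i. \<omega> e})"
      using False by auto
    also have "P.prob \<dots> = (\<Prod>i\<in>I. P.prob {\<omega> \<in> space ?M. \<exists>e\<in>C i. \<omega> e})"
    proof -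
      let ?U = "\<lambda>i. (\<lambda>\<omega>. restrict (\<lambda>e. \<omega> e) (C i)) -` ?A i \<inter> space ?M"
      have "(\<Inter>i\<in>I. {\<omega> \<in> space ?M. \<exists>e\<in>C i. \<omega> e}) = (\<Inter>i\<in>I. ?U i)"
        by (intro INF_cong refl) (simp only: restr)
      then have "P.prob (\<Inter>i\<in>I. {\<omega> \<in> space ?M. \<exists>e\<in>C i. \<omega> e}) = P.prob (\<Inter>i\<in>I. ?U i)"
        by (simp only:)
      also have "\<dots> = (\<Prod>i\<in>I. P.prob (?U i))"
        by (rule P.indep_varsD_finite[OF indepC _ I A]) (use False in auto)
      also have "\<dots> = (\<Prod>i\<in>I. P.prob {\<omega> \<in> space ?M. \<exists>e\<in>C i. \<omega> e})"
        by (intro prod.cong refl) (simp only: restr)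
      finally show ?thesis .
    qed
    also have "\<dots> \<le> (\<Prod>i\<in>I. 1 - (1 - p) ^ N)"
      using single by (intro prod_mono) (auto simp: measure_nonneg)
    finally show ?thesis by simp
  qed
qed

section \<open>Exponential decay of connection probabilities\<close>

theorem mainTheorem2:
  fixes d :: nat and V :: "'a set" and E E' :: "'a set set"
    and \<xi> :: "(nat \<Rightarrow> 'a) set" and L :: "('a \<Rightarrow> 'a) set" and p :: real
  assumes "decorated_tree d V E \<xi> L E'"
    and "0 \<le> p" and "p < 1"
  shows "\<exists>c>0. \<forall>x\<in>V. \<forall>y\<in>V.
    measure (percolation (E \<union> E') p) (connection_event V (E \<union> E') p x y)
      \<le> exp (- c * real (graph_dist V (E \<union> E') x y))"
proof -
  interpret decorated_tree d V E \<xi> L E' by (rule assms(1))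
  let ?F = "E \<union> E'"
  let ?M = "percolation ?F p"
  interpret P: prob_space ?M
    unfolding percolation_def by (rule prob_space_PiM) (rule prob_space_measure_pmf)
  obtain R where R: "\<And>a b. {a, b} \<in> ?F \<Longrightarrow> close_by E R a b" using bounded_range by blast
  obtain N where N: "\<And>v C. v \<in> V \<Longrightarrow> C \<subseteq> ?F \<Longrightarrow> (\<And>e a. e \<in> C \<Longrightarrow> a \<in> e \<Longrightarrow> close_by E R a v)
    \<Longrightarrow> finite C \<and> card C \<le> N" using bounded_edges_near[of R] by metis
  define q0 where "q0 = 1 - (1 - p) ^ N"
  have q0: "0 \<le> q0" "q0 < 1"
    using assms(2,3) by (auto simp: q0_def power_le_one)
  \<comment> \<open>Averaging with \<open>1\<close> keeps the base positive even if \<open>q0 = 0\<close>, so that its logarithm is meaningful.\<close>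
  define q where "q = (1 + q0) / 2"
  have q: "q0 \<le> q" "0 < q" "q < 1" using q0 by (auto simp: q_def)
  define M where "M = 2 * R + 1"
  define c where "c = - ln q / real M"
  have "c > 0" using q by (auto simp: c_def M_def divide_simps)
  moreover have "P.prob (connection_event V ?F p x y) \<le> exp (- c * real (graph_dist V ?F x y))"
    if xy: "x \<in> V" "y \<in> V" for x y
  proof -
    obtain k where "(x, y) \<in> adj E ^^ k" using tree_connected[OF xy] by blast
    then obtain n f where f: "f 0 = x" "f n = y" "\<forall>i<n. (f i, f (Suc i)) \<in> adj E"
      "\<forall>m. (x, y) \<in> adj E ^^ m \<longrightarrow> n \<le> m" by (rule obtain_shortest_walk)
    have short: "\<And>m. (f 0, f n) \<in> adj E ^^ m \<Longrightarrow> n \<le> m" using f by simp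
    have fV: "f i \<in> V" if "i < n" for i
      using that f(3) edge_ends_in_V by (auto simp: adj_def)
    \<comment> \<open>The number of cuts is \<open>n / M\<close> rounded up, so that no multiplicative constant is lost.\<close>
    define m where "m = (n + M - 1) div M"
    have M0: "0 < M" by (simp add: M_def)
    have nm: "n \<le> m * M"
    proof -
      have "n + M - 1 < m * M + M"
        unfolding m_def using M0 dividend_less_div_times[of M "n + M - 1"] by (simp add: add.commute)
      then show ?thesis using M0 by linarith
    qed
    have index: "j * M < n" if "j < m" for j
    proof -
      have "Suc j * M \<le> m * M" using that by (intro mult_le_mono1) simp
      also have "\<dots> \<le> n + M - 1" unfolding m_def by (rule div_times_less_eq_dividend)
      finally show ?thesis using M0 by simp
    qed
    have "\<exists>S. f 0 \<in> S \<and> f n \<notin> S \<and> (\<forall>e\<in>edge_cut ?F S. \<forall>a\<in>e. close_by E R a (f (j * M)))"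
      if j: "j < m" for j
      using tree_cut[OF tree f(3) short index[OF j] R] by metis
    then obtain S where S: "\<And>j. j < m \<Longrightarrow> x \<in> S j" "\<And>j. j < m \<Longrightarrow> y \<notin> S j"
      "\<And>j e a. j < m \<Longrightarrow> e \<in> edge_cut ?F (S j) \<Longrightarrow> a \<in> e \<Longrightarrow> close_by E R a (f (j * M))"
      unfolding f(1,2) by metis
    let ?C = "\<lambda>j. edge_cut ?F (S j)"
    have sub: "?C j \<subseteq> ?F" for j by (auto simp: edge_cut_def)
    have cut: "finite (?C j)" "card (?C j) \<le> N" if "j < m" for j
      using N[OF fV[OF index[OF that]] sub S(3)[OF that]] by auto
    \<comment> \<open>A common edge would place \<open>f (i * M)\<close> and \<open>f (j * M)\<close> at distance at most \<open>2 * R < M\<close>.\<close>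
    have "?C i \<inter> ?C j = {}" if ij: "i < j" "j < m" for i j
    proof (rule ccontr)
      assume "?C i \<inter> ?C j \<noteq> {}"
      then obtain e a where "e \<in> ?C i" "e \<in> ?C j" "a \<in> e" by (auto simp: edge_cut_def)
      then have "close_by E R a (f (i * M))" "close_by E R a (f (j * M))" using S(3) ij by auto
      then obtain k l where kl: "k \<le> R" "l \<le> R" "(f (i * M), a) \<in> adj E ^^ k"
        "(a, f (j * M)) \<in> adj E ^^ l" using close_by_sym unfolding close_by_def by metis
      have "j * M - i * M \<le> k + l"
        by (rule shortest_walk_relpow[OF f(3) short _ _ relpow_trans[OF kl(3,4)]])
          (use ij index[OF ij(2)] in auto)
      moreover have "i * M + M \<le> j * M" using ij mult_le_mono1[of "Suc i" j M] by simp
      ultimately show False using kl(1,2) by (simp add: M_def)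
    qed
    then have disj: "disjoint_family_on ?C {..<m}"
      unfolding disjoint_family_on_def by (metis Int_commute lessThan_iff linorder_neqE_nat)
    let ?A = "{\<omega> \<in> space ?M. \<forall>j\<in>{..<m}. \<exists>e\<in>?C j. \<omega> e}"
    have "connection_event V ?F p x y \<subseteq> ?A"
      using joined_meets_edge_cut[OF _ S(1,2)] by (auto simp: connection_event_def)
    moreover have "?A \<in> P.events"
    proof (intro sets.sets_Collect_finite_All sets.sets_Collect_finite_Ex finite_lessThan)
      fix j e assume j: "j \<in> {..<m}"
      show "finite (?C j)" using cut j by simp
      assume "e \<in> ?C j"
      then have "e \<in> ?F" using sub by blast
      then have "(\<lambda>\<omega>. \<omega> e) \<in> measurable ?M (measure_pmf (bernoulli_pmf p))"
        unfolding percolation_def by (rule measurable_component_singleton)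
      from measurable_sets[OF this, of "{True}"]
      show "{\<omega> \<in> space ?M. \<omega> e} \<in> P.events" by (simp add: vimage_def Int_def conj_commute)
    qed
    ultimately have "P.prob (connection_event V ?F p x y) \<le> P.prob ?A"
      by (rule P.finite_measure_mono)
    also have "\<dots> \<le> q0 ^ m"
      using prob_open_in_disjoint_sets[of p "{..<m}" ?C ?F N] assms(2,3) sub cut disj
      by (simp add: q0_def)
    also have "\<dots> \<le> q ^ m" using q q0 by (intro power_mono)
    also have "\<dots> = exp (- c * real (m * M))"
      using q M0 by (simp add: c_def exp_of_nat2_mult)
    also have "\<dots> \<le> exp (- c * real (graph_dist V ?F x y))"
    proof -
      have "(x, y) \<in> adj E ^^ n" using f(1-3) by (auto simp: relpow_fun_conv)
      then have "(x, y) \<in> adj ?F ^^ n" 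
        by (rule relpow_map[where h = "\<lambda>z. z"]) (auto simp: adj_def)
      then have "graph_dist V ?F x y \<le> n" using xy(1) edges_subset by (rule graph_dist_le_relpow)
      then show ?thesis using nm \<open>c > 0\<close> by (simp del: of_nat_mult)
    qed
    finally show ?thesis .
  qed
  ultimately show ?thesis by blast
qed

end
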